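(* Let $D\subset\mathbb{C}^n$ be a bounded B-regular domain and let $\phi\in\mathrm{PSH}^-(D)$. The relation $$P[\phi](\psi)=P(\psi,g_\phi)$$ holds for every $\psi\in\mathrm{PSH}^-(D)$, provided one of the following conditions is fulfilled: (i) $\phi\ge g_\phi+w$ with some $w\in\mathrm{PSH}^-(D)$ such that $g_w=0$; (ii) $g_\phi=0$; (iii) $\phi$ has approximately model singularity in $D$.
   Context: A bounded domain $D\subset\mathbb{C}^n$ is B-regular if every continuous function on $\partial D$ is the boundary value of a function psh in $D$ and continuous on $\overline D$. $\mathrm{PSH}^-(D)$ is the set of negative (i.e. $\le 0$) plurisubharmonic (psh) functions on $D$, not identically $-\infty$. For psh $u,v$ on $D$, the rooftop envelope $P(u,v)$ is the largest psh minorant of $\min\{u,v\}$ on $D$. For $\phi,\psi\in\mathrm{PSH}^-(D)$, the asymptotic rooftop $P[\phi](\psi)$ of $\psi$ with respect to the singularity of $\phi$ is the upper semicontinuous regularization of $\sup_{C\in\mathbb{R}}P(\psi,\phi+C)$. The Green-Poisson residual function $g_\phi$ is the upper semicontinuous regularization of $\sup\{w:\ w\in\mathrm{PSH}^-(D),\ w\le\phi+C_w\text{ on }D\text{ for some }C_w\in\mathbb{R}\}$. $\phi\in\mathrm{PSH}^-(D)$ has approximately model singularity in $D$ if for every $\sigma\in(0,1)$ there is $C_\sigma\in\mathbb{R}$ such that $g_\phi\le\sigma\phi+C_\sigma$ on $D$. *)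

theory Defs
  imports "HOL-Analysis.Analysis"
begin

text \<open>
  Functions on a set \<open>D\<close> are total functions of which only the values on \<open>D\<close> matter;
  (pluri)subharmonic functions are \<open>ereal\<close>-valued, and the constant \<open>-\<infinity>\<close> is admitted
  as (pluri)subharmonic.
\<close>

definition usc_on :: "'a::topological_space set \<Rightarrow> ('a \<Rightarrow> ereal) \<Rightarrow> bool" where
  "usc_on S u \<longleftrightarrow> (\<forall>z\<in>S. \<forall>c. u z < c \<longrightarrow> (\<forall>\<^sub>F x in at z within S. u x < c))"

text \<open>The filter contains the point \<open>z\<close> itself, so that \<open>f \<le> usc_reg S f\<close> on \<open>S\<close>.\<close>

definition usc_reg :: "'a::topological_space set \<Rightarrow> ('a \<Rightarrow> ereal) \<Rightarrow> 'a \<Rightarrow> ereal" where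
  "usc_reg S f z = Limsup (inf (nhds z) (principal S)) f"

text \<open>
  The mean over the circle is the Lebesgue integral of the positive part minus that of the negative
  part (\<open>e2ennreal\<close> truncates negative values to 0). For upper semicontinuous \<open>u < \<infinity>\<close> the
  former is finite, so the difference is unambiguous, with value \<open>-\<infinity>\<close> allowed.
\<close>

definition circle_mean :: "(complex \<Rightarrow> ereal) \<Rightarrow> complex \<Rightarrow> real \<Rightarrow> ereal" where
  "circle_mean u a r = ereal (1 / (2 * pi)) *
     (enn2ereal (\<integral>\<^sup>+t\<in>{0..2*pi}. e2ennreal (u (a + of_real r * cis t)) \<partial>lborel)
      - enn2ereal (\<integral>\<^sup>+t\<in>{0..2*pi}. e2ennreal (- u (a + of_real r * cis t)) \<partial>lborel))"

definition subharmonic_on :: "complex set \<Rightarrow> (complex \<Rightarrow> ereal) \<Rightarrow> bool" where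
  "subharmonic_on \<Omega> u \<longleftrightarrow> usc_on \<Omega> u \<and> (\<forall>\<zeta>\<in>\<Omega>. u \<zeta> < \<infinity>) \<and>
     (\<forall>a r. 0 < r \<and> cball a r \<subseteq> \<Omega> \<longrightarrow> u a \<le> circle_mean u a r)"

definition psh_on :: "(complex^'n) set \<Rightarrow> (complex^'n \<Rightarrow> ereal) \<Rightarrow> bool" where
  "psh_on D u \<longleftrightarrow> usc_on D u \<and> (\<forall>z\<in>D. u z < \<infinity>) \<and>
     (\<forall>z w. subharmonic_on {\<zeta>. z + \<zeta> *s w \<in> D} (\<lambda>\<zeta>. u (z + \<zeta> *s w)))"

definition PSH_neg :: "(complex^'n) set \<Rightarrow> (complex^'n \<Rightarrow> ereal) set" where
  "PSH_neg D = {u. psh_on D u \<and> (\<forall>z\<in>D. u z \<le> 0) \<and> (\<exists>z\<in>D. u z \<noteq> -\<infinity>)}"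

definition bounded_domain :: "(complex^'n) set \<Rightarrow> bool" where
  "bounded_domain D \<longleftrightarrow> open D \<and> connected D \<and> D \<noteq> {} \<and> bounded D"

definition B_regular :: "(complex^'n) set \<Rightarrow> bool" where
  "B_regular D \<longleftrightarrow> (\<forall>f :: complex^'n \<Rightarrow> real. continuous_on (frontier D) f \<longrightarrow>
     (\<exists>u :: complex^'n \<Rightarrow> real. continuous_on (closure D) u \<and>
        psh_on D (\<lambda>z. ereal (u z)) \<and> (\<forall>z\<in>frontier D. u z = f z)))"

definition largest_psh_minorant ::
    "(complex^'n) set \<Rightarrow> (complex^'n \<Rightarrow> ereal) \<Rightarrow> (complex^'n \<Rightarrow> ereal) \<Rightarrow> bool" where
  "largest_psh_minorant D f p \<longleftrightarrow> psh_on D p \<and> (\<forall>z\<in>D. p z \<le> f z) \<and>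
     (\<forall>w. psh_on D w \<and> (\<forall>z\<in>D. w z \<le> f z) \<longrightarrow> (\<forall>z\<in>D. w z \<le> p z))"

text \<open>The value \<open>-\<infinity>\<close> off \<open>D\<close> is a dummy that makes the total function unique.\<close>

definition rooftop ::
    "(complex^'n) set \<Rightarrow> (complex^'n \<Rightarrow> ereal) \<Rightarrow> (complex^'n \<Rightarrow> ereal) \<Rightarrow> complex^'n \<Rightarrow> ereal" where
  "rooftop D u v =
     (THE p. largest_psh_minorant D (\<lambda>z. min (u z) (v z)) p \<and> (\<forall>z. z \<notin> D \<longrightarrow> p z = -\<infinity>))"

lemma rooftop_eqI:
  assumes "largest_psh_minorant D (\<lambda>z. min (u z) (v z)) p" "\<And>z. z \<notin> D \<Longrightarrow> p z = -\<infinity>"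
  shows "rooftop D u v = p"
  unfolding rooftop_def
proof (rule the_equality)
  fix q
  assume q: "largest_psh_minorant D (\<lambda>z. min (u z) (v z)) q \<and> (\<forall>z. z \<notin> D \<longrightarrow> q z = -\<infinity>)"
  show "q = p"
  proof
    fix z
    show "q z = p z"
    proof (cases "z \<in> D")
      case True
      with q assms(1) show ?thesis
        unfolding largest_psh_minorant_def by (meson order_antisym)
    qed (use q assms(2) in simp)
  qed
qed (use assms in blast)

definition asymptotic_rooftop ::
    "(complex^'n) set \<Rightarrow> (complex^'n \<Rightarrow> ereal) \<Rightarrow> (complex^'n \<Rightarrow> ereal) \<Rightarrow> complex^'n \<Rightarrow> ereal" where
  "asymptotic_rooftop D \<phi> \<psi> =
     usc_reg D (\<lambda>z. SUP C::real. rooftop D \<psi> (\<lambda>x. \<phi> x + ereal C) z)"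

definition green_poisson ::
    "(complex^'n) set \<Rightarrow> (complex^'n \<Rightarrow> ereal) \<Rightarrow> complex^'n \<Rightarrow> ereal" where
  "green_poisson D \<phi> =
     usc_reg D (\<lambda>z. SUP w\<in>{w \<in> PSH_neg D. \<exists>C::real. \<forall>x\<in>D. w x \<le> \<phi> x + ereal C}. w z)"

definition approx_model_singularity ::
    "(complex^'n) set \<Rightarrow> (complex^'n \<Rightarrow> ereal) \<Rightarrow> bool" where
  "approx_model_singularity D \<phi> \<longleftrightarrow>
     (\<forall>\<sigma>::real. 0 < \<sigma> \<and> \<sigma> < 1 \<longrightarrow>
        (\<exists>C::real. \<forall>z\<in>D. green_poisson D \<phi> z \<le> ereal \<sigma> * \<phi> z + ereal C))"

end

theory Submission
  imports Defs
begin

text \<open>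
  Put \<open>h = P(\<psi>, g\<^sub>\<phi>)\<close>. Each \<open>P(\<psi>, \<phi> + C)\<close> competes for \<open>g\<^sub>\<phi>\<close>, which gives \<open>P[\<phi>](\<psi>) \<le> h\<close>. For the
  converse, psh minorants of \<open>\<psi>\<close> and of some \<open>\<phi> + C\<close> are built from \<open>h\<close>. Under (iii) they are
  \<open>h / \<sigma>\<close>, with \<open>\<sigma> \<rightarrow> 1\<close>. Under (i) they are \<open>h + v\<close> with \<open>v\<close> a competitor for \<open>g\<^sub>w\<close>; that \<open>g\<^sub>w = 0\<close>
  yields competitors with ball means arbitrarily close to 0, so the submean inequality over small
  balls gives \<open>h \<le> P[\<phi>](\<psi>)\<close> at every point. Condition (ii) is the case \<open>w = \<phi>\<close> of (i).
\<close>

section \<open>Upper semicontinuous functions\<close>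

text \<open>The punctured filter in \<open>usc_on\<close> loses nothing because the bound already
  holds at \<open>z\<close>, and openness of \<open>D\<close> turns \<open>at z within D\<close>
  into \<open>at z\<close>. Later semicontinuity proofs become set algebra.\<close>

lemma usc_on_iff_open_sublevel:
  assumes "open D"
  shows "usc_on D u \<longleftrightarrow> (\<forall>c. open {x \<in> D. u x < c})"
proof
  assume u: "usc_on D u"
  show "\<forall>c. open {x \<in> D. u x < c}"
  proof
    fix c
    show "open {x \<in> D. u x < c}"
    proof (subst open_subopen, safe)
      fix z assume z: "z \<in> D" "u z < c"
      with u assms have "\<forall>\<^sub>F x in at z. u x < c"
        unfolding usc_on_def by (metis at_within_open)
      with z have "\<forall>\<^sub>F x in nhds z. u x < c"
        unfolding eventually_at_filter by (auto elim!: eventually_mono)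
      then obtain S where "open S" "z \<in> S" "\<forall>x\<in>S. u x < c"
        unfolding eventually_nhds by blast
      then show "\<exists>T. open T \<and> z \<in> T \<and> T \<subseteq> {x \<in> D. u x < c}"
        using z assms by (intro exI[of _ "S \<inter> D"]) auto
    qed
  qed
next
  assume *: "\<forall>c. open {x \<in> D. u x < c}"
  show "usc_on D u"
    unfolding usc_on_def eventually_at_topological
  proof (intro ballI allI impI)
    fix z c assume "z \<in> D" "u z < c"
    then show "\<exists>S. open S \<and> z \<in> S \<and> (\<forall>x\<in>S. x \<noteq> z \<longrightarrow> x \<in> D \<longrightarrow> u x < c)"
      using * by (intro exI[of _ "{x \<in> D. u x < c}"]) auto
  qed
qed

lemma usc_on_min:
  assumes "open D" "usc_on D u" "usc_on D v"
  shows "usc_on D (\<lambda>z. min (u z) (v z))"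
proof -
  have "{x \<in> D. min (u x) (v x) < c} = {x \<in> D. u x < c} \<union> {x \<in> D. v x < c}" for c
    by (auto simp: min_less_iff_disj)
  then show ?thesis
    using assms by (simp add: usc_on_iff_open_sublevel open_Un)
qed

lemma usc_on_add_const:
  assumes "open D" "usc_on D u"
  shows "usc_on D (\<lambda>z. u z + ereal C)"
proof -
  have "u x + ereal C < c \<longleftrightarrow> u x < c - ereal C" for x c
    by (cases "u x"; cases c) auto
  then show ?thesis
    using assms by (simp add: usc_on_iff_open_sublevel)
qed

lemma usc_on_mult_const:
  assumes "open D" "usc_on D u" "k > 0"
  shows "usc_on D (\<lambda>z. ereal k * u z)"
proof -
  have "ereal k * u x < c \<longleftrightarrow> u x < c / ereal k" for x c
    using \<open>k > 0\<close> by (simp add: ereal_less_divide_pos)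
  then show ?thesis
    using assms by (simp add: usc_on_iff_open_sublevel)
qed

text \<open>Nonpositivity excludes \<infinity> - \<infinity> and lets either summand alone bound the
  sum from above, which settles points where one value is -\<infinity>.\<close>

lemma usc_on_add_nonpos:
  assumes "open D" "usc_on D u" "usc_on D v"
    and neg: "\<And>x. x \<in> D \<Longrightarrow> u x \<le> 0" "\<And>x. x \<in> D \<Longrightarrow> v x \<le> 0"
  shows "usc_on D (\<lambda>z. u z + v z)"
  unfolding usc_on_iff_open_sublevel[OF \<open>open D\<close>]
proof
  fix c
  \<comment> \<open>Separate thresholds for \<open>u\<close> and \<open>v\<close> suffice, since
    they cut out an intersection of two open sublevel sets.\<close>
  have split: "\<exists>a b. u z < a \<and> v z < b \<and> (\<forall>x\<in>D. u x < a \<longrightarrow> v x < b \<longrightarrow> u x + v x < c)"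
    if z: "z \<in> D" "u z + v z < c" for z
  proof (cases "u z = -\<infinity> \<or> v z = -\<infinity>")
    case True
    have *: "u x + v x < c" if "x \<in> D" "u x < c \<or> v x < c" for x
      using that neg[of x] add_mono[of "u x" "u x" "v x" 0] add_mono[of "u x" 0 "v x" "v x"]
      by auto
    have "c \<noteq> -\<infinity>" using z by auto
    with True consider "u z < c" | "v z < c" by (cases c) auto
    then show ?thesis
    proof cases
      \<comment> \<open>The threshold 1 for the other summand is vacuous, as its values are at most
        0.\<close>
      case 1
      with * z neg[of z] show ?thesis
        by (intro exI[of _ c] exI[of _ 1]) (auto intro: le_less_trans)
    next
      case 2
      with * z neg[of z] show ?thesis
        by (intro exI[of _ 1] exI[of _ c]) (auto intro: le_less_trans)
    qed
  next
    case False
    with neg[of z] z obtain p q where r: "u z = ereal p" "v z = ereal q"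
      by (cases "u z"; cases "v z") auto
    then have "ereal (p + q) < c" using z by simp
    then obtain r where c: "p + q < r" "ereal r < c"
      using ereal_dense2 by (metis ereal_less_eq(3) not_le less_ereal.simps(1))
    \<comment> \<open>Half of the slack r - (p + q), so that the two thresholds add up to
      \<open>r\<close>.\<close>
    let ?e = "(r - p - q) / 2"
    have "?e > 0" using c by simp
    moreover have "u x + v x < c" if "u x < ereal (p + ?e)" "v x < ereal (q + ?e)" for x
    proof -
      have "u x + v x < ereal r"
        using that by (cases "u x"; cases "v x") (auto simp: field_simps)
      with c show ?thesis by simp
    qed
    ultimately show ?thesis
      using r by (intro exI[of _ "ereal (p + ?e)"] exI[of _ "ereal (q + ?e)"]) auto
  qed
  show "open {x \<in> D. u x + v x < c}"
  proof (subst open_subopen, safe)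
    fix z assume "z \<in> D" "u z + v z < c"
    with split obtain a b where
      "u z < a" "v z < b" "\<forall>x\<in>D. u x < a \<longrightarrow> v x < b \<longrightarrow> u x + v x < c" by blast
    then show "\<exists>T. open T \<and> z \<in> T \<and> T \<subseteq> {x \<in> D. u x + v x < c}"
      using assms(2,3) \<open>z \<in> D\<close> unfolding usc_on_iff_open_sublevel[OF \<open>open D\<close>]
      by (intro exI[of _ "{x \<in> D. u x < a} \<inter> {x \<in> D. v x < b}"]) auto
  qed
qed

section \<open>Upper semicontinuous regularization\<close>

text \<open>The uniform bound by some \<open>c'\<close> strictly below \<open>c\<close> matters:
  values that are merely below \<open>c\<close> could still accumulate at \<open>c\<close>.\<close>

lemma usc_reg_less_iff:
  "usc_reg S f z < c \<longleftrightarrow>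
     (\<exists>c'<c. \<exists>U. open U \<and> z \<in> U \<and> (\<forall>x\<in>U \<inter> S. f x \<le> c'))"
proof
  assume less: "usc_reg S f z < c"
  then obtain c' where c': "usc_reg S f z < c'" "c' < c"
    using dense by blast
  from Limsup_lessD[OF c'(1)[unfolded usc_reg_def]]
  show "\<exists>c'<c. \<exists>U. open U \<and> z \<in> U \<and> (\<forall>x\<in>U \<inter> S. f x \<le> c')"
    unfolding eventually_inf_principal eventually_nhds
    using c'(2) by (meson IntD1 IntD2 less_imp_le)
next
  assume "\<exists>c'<c. \<exists>U. open U \<and> z \<in> U \<and> (\<forall>x\<in>U \<inter> S. f x \<le> c')"
  then obtain c' U where c': "c' < c" and U: "open U" "z \<in> U" "\<forall>x\<in>U \<inter> S. f x \<le> c'"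
    by blast
  have "\<forall>\<^sub>F x in inf (nhds z) (principal S). f x \<le> c'"
    unfolding eventually_inf_principal eventually_nhds using U by blast
  \<comment> \<open>Off the closure of \<open>S\<close> the filter is trivial and
    \<open>Limsup\<close> equals -\<infinity>.\<close>
  then have "usc_reg S f z \<le> c'"
    unfolding usc_reg_def
    by (cases "inf (nhds z) (principal S) = bot") (auto simp: Limsup_bounded bot_ereal_def)
  with c' show "usc_reg S f z < c" by simp
qed

lemma le_usc_reg: "z \<in> S \<Longrightarrow> f z \<le> usc_reg S f z"
  by (rule ccontr) (auto simp: not_le usc_reg_less_iff dest: bspec)

lemma usc_reg_le:
  assumes "open S" "usc_on S g" "\<And>x. x \<in> S \<Longrightarrow> f x \<le> g x" "z \<in> S"
  shows "usc_reg S f z \<le> g z"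
proof (rule dense_ge)
  fix c assume "g z < c"
  then obtain c' where c': "g z < c'" "c' < c"
    using dense by blast
  then show "usc_reg S f z \<le> c"
    using assms unfolding usc_on_iff_open_sublevel[OF \<open>open S\<close>]
    by (intro less_imp_le usc_reg_less_iff[THEN iffD2] exI[of _ c'] conjI
          exI[of _ "{x \<in> S. g x < c'}"]) (auto intro: order_trans[OF _ less_imp_le])
qed

lemma usc_on_usc_reg:
  assumes "open S"
  shows "usc_on S (usc_reg S f)"
  unfolding usc_on_iff_open_sublevel[OF assms]
proof
  fix c
  show "open {x \<in> S. usc_reg S f x < c}"
  proof (subst open_subopen, safe)
    fix z assume z: "z \<in> S" "usc_reg S f z < c"
    then obtain c' U where "c' < c" "open U" "z \<in> U" "\<forall>x\<in>U \<inter> S. f x \<le> c'"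
      unfolding usc_reg_less_iff by blast
    then show "\<exists>T. open T \<and> z \<in> T \<and> T \<subseteq> {x \<in> S. usc_reg S f x < c}"
      using z assms by (intro exI[of _ "U \<inter> S"]) (auto simp: usc_reg_less_iff)
  qed
qed

section \<open>Isometry invariance of Lebesgue measure\<close>

lemma nn_integral_lborel_translate:
  fixes f :: "'a::euclidean_space \<Rightarrow> ennreal"
  assumes [measurable]: "f \<in> borel_measurable borel"
  shows "(\<integral>\<^sup>+x. f (c + x) \<partial>lborel) = (\<integral>\<^sup>+x. f x \<partial>lborel)"
  by (subst (2) lborel_distr_plus[of c, symmetric]) (simp add: nn_integral_distr)

text \<open>
  The Fubini argument for uniqueness of Haar measure: the image of Lebesgue measure under an
  isometry is translation invariant and gives the unit ball the same volume.
\<close>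

lemma nn_integral_lborel_linear_isometry:
  fixes T :: "'a::euclidean_space \<Rightarrow> 'a" and f :: "'a \<Rightarrow> ennreal"
  assumes T: "linear T" "\<And>x. norm (T x) = norm x"
    and f[measurable]: "f \<in> borel_measurable borel"
  shows "(\<integral>\<^sup>+x. f (T x) \<partial>lborel) = (\<integral>\<^sup>+x. f x \<partial>lborel)"
proof -
  interpret linear T by fact
  have [measurable]: "T \<in> borel_measurable borel"
    by (intro borel_measurable_continuous_onI linear_continuous_on linear_conv_bounded_linear[THEN iffD1] T)
  have "inj T"
    by (metis T(2) injI diff right_minus_eq norm_eq_zero)
  then have "surj T"
    using T(1) linear_injective_imp_surjective by blast
  \<comment> \<open>The ball indicator is invariant under isometries fixing 0 and has a finite
    nonzero integral, so \<open>V\<close> can be cancelled at the end.\<close>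
  define g :: "'a \<Rightarrow> ennreal" where "g = indicator (ball 0 1)"
  define V where "V = (\<integral>\<^sup>+x. g x \<partial>lborel)"
  have [measurable]: "g \<in> borel_measurable borel" by (simp add: g_def borel_measurable_indicator)
  have V: "V \<noteq> 0" "V \<noteq> \<infinity>"
    unfolding V_def g_def using emeasure_lborel_ball_finite[of 0 1] content_ball_pos[of 1 "0::'a"]
    by (auto simp: less_top measure_def)
  have transl: "(\<integral>\<^sup>+x. f (T x + y) \<partial>lborel) = (\<integral>\<^sup>+x. f (T x) \<partial>lborel)" for y
  proof -
    obtain b where "y = T b" using \<open>surj T\<close> by blast
    then show ?thesis
      using nn_integral_lborel_translate[of "\<lambda>x. f (T x)" b] by (simp add: add ac_simps)
  qed
  have vol: "(\<integral>\<^sup>+x. g (y - T x) \<partial>lborel) = V" for y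
  proof -
    obtain b where "y = T b" using \<open>surj T\<close> by blast
    then have "norm (y - T x) = norm (- b + x)" for x
      by (metis T(2) diff norm_minus_commute uminus_add_conv_diff)
    then have "g (y - T x) = g (- b + x)" for x
      by (auto simp: g_def indicator_def)
    then have "(\<integral>\<^sup>+x. g (y - T x) \<partial>lborel) = (\<integral>\<^sup>+x. g (- b + x) \<partial>lborel)"
      by (rule nn_integral_cong)
    then show ?thesis
      unfolding V_def using nn_integral_lborel_translate[of g "- b"] by simp
  qed
  \<comment> \<open>The double integral is evaluated twice with \<open>x\<close> innermost:
    directly, where \<open>transl\<close> applies, and after the shift of \<open>y\<close> by
    \<open>T x\<close>, where \<open>vol\<close> applies. Fubini is used before and after the
    shift.\<close>
  have "(\<integral>\<^sup>+x. f (T x) \<partial>lborel) * V = (\<integral>\<^sup>+y. (\<integral>\<^sup>+x. f (T x + y) * g y \<partial>lborel) \<partial>lborel)"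
    by (simp add: V_def nn_integral_multc nn_integral_cmult transl)
  also have "\<dots> = (\<integral>\<^sup>+x. (\<integral>\<^sup>+y. f (T x + y) * g y \<partial>lborel) \<partial>lborel)"
    by (rule lborel_pair.Fubini') (simp add: borel_prod[symmetric])
  also have "\<dots> = (\<integral>\<^sup>+x. (\<integral>\<^sup>+y. f y * g (y - T x) \<partial>lborel) \<partial>lborel)"
  proof (rule nn_integral_cong)
    fix x
    show "(\<integral>\<^sup>+y. f (T x + y) * g y \<partial>lborel) = (\<integral>\<^sup>+y. f y * g (y - T x) \<partial>lborel)"
      using nn_integral_lborel_translate[of "\<lambda>y. f y * g (y - T x)" "T x"] by simp
  qed
  also have "\<dots> = (\<integral>\<^sup>+y. (\<integral>\<^sup>+x. f y * g (y - T x) \<partial>lborel) \<partial>lborel)"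
    by (rule lborel_pair.Fubini'[symmetric]) (simp add: borel_prod[symmetric])
  also have "\<dots> = (\<integral>\<^sup>+x. f x \<partial>lborel) * V"
    by (simp add: nn_integral_multc nn_integral_cmult vol)
  finally show ?thesis
    using V by (metis ennreal_mult_divide_eq infinity_ennreal_def)
qed

section \<open>Nonpositive psh functions\<close>

text \<open>
  Nonpositive functions are handled through their negatives, which are lower semicontinuous with
  values in \<open>ennreal\<close>, so that no integrability question arises. The value 0 off \<open>D\<close> keeps
  \<open>depth D u\<close> lower semicontinuous on the whole space.
\<close>

definition depth :: "'a set \<Rightarrow> ('a \<Rightarrow> ereal) \<Rightarrow> 'a \<Rightarrow> ennreal" where
  "depth D u x = (if x \<in> D then e2ennreal (- u x) else 0)"

text \<open>Normalized to total mass 1, so that an average over rotations of a quantity independent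
  of the angle returns that quantity.\<close>

abbreviation circle_measure :: "real measure" where
  "circle_measure \<equiv> uniform_measure lborel {0..2 * pi}"

text \<open>The radius is absorbed into \<open>w\<close>, so unit discs z + \<zeta> w cover all
  discs in complex lines.\<close>

definition disc_mean ::
    "(complex^'n) set \<Rightarrow> (complex^'n \<Rightarrow> ereal) \<Rightarrow> complex^'n \<Rightarrow> complex^'n \<Rightarrow> ennreal" where
  "disc_mean D u z w = (\<integral>\<^sup>+t. depth D u (z + cis t *s w) \<partial>circle_measure)"

lemma less_e2ennreal_iff: "y < e2ennreal a \<longleftrightarrow> enn2ereal y < a"
proof (cases "0 \<le> a")
  case True
  then show ?thesis by (simp add: less_ennreal.rep_eq enn2ereal_e2ennreal)
next
  case False
  then have "\<not> enn2ereal y < a"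
    by (metis enn2ereal_nonneg le_less_trans less_imp_le)
  with False show ?thesis by (simp add: e2ennreal_neg)
qed

lemma open_depth_superlevel:
  assumes "open D" "usc_on D u"
  shows "open {x. y < depth D u x}"
proof -
  have "{x. y < depth D u x} = {x \<in> D. u x < - enn2ereal y}"
    by (auto simp: depth_def less_e2ennreal_iff ereal_less_uminus_reorder split: if_splits)
  with assms show ?thesis
    by (simp add: usc_on_iff_open_sublevel)
qed

lemma borel_measurable_depth:
  fixes u :: "'a::topological_space \<Rightarrow> ereal"
  assumes "open D" "usc_on D u"
  shows "depth D u \<in> borel_measurable borel"
  by (rule borel_measurableI_greater) (simp add: open_depth_superlevel assms)

lemma depth_le_liminf:
  assumes "open D" "usc_on D u" and lim: "X \<longlonglongrightarrow> x"
  shows "depth D u x \<le> liminf (\<lambda>n. depth D u (X n))"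
  unfolding le_Liminf_iff
  using topological_tendstoD[OF lim open_depth_superlevel[OF assms(1,2)]] by simp

lemma depth_antimono: "(\<And>x. x \<in> D \<Longrightarrow> u x \<le> v x) \<Longrightarrow> depth D v x \<le> depth D u x"
  by (simp add: depth_def e2ennreal_mono)

text \<open>Both negatives are nonnegative, so the truncation in \<open>e2ennreal\<close> never acts
  and additivity survives, infinite values included.\<close>

lemma depth_add:
  assumes "\<And>x. x \<in> D \<Longrightarrow> u x \<le> 0" "\<And>x. x \<in> D \<Longrightarrow> v x \<le> 0"
  shows "depth D (\<lambda>z. u z + v z) x = depth D u x + depth D v x"
proof (cases "x \<in> D")
  case True
  then show ?thesis
    using assms[of x]
    by (cases "u x"; cases "v x") (auto simp: depth_def ennreal_plus[symmetric] simp del: ennreal_plus)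
qed (simp add: depth_def)

lemma depth_mult:
  assumes "k > 0" "\<And>x. x \<in> D \<Longrightarrow> u x \<le> 0"
  shows "depth D (\<lambda>z. ereal k * u z) x = ennreal k * depth D u x"
proof (cases "x \<in> D")
  case True
  then show ?thesis
    using assms(1) assms(2)[of x]
    by (cases "u x") (auto simp: depth_def ennreal_mult'[symmetric] ennreal_mult_top)
qed (simp add: depth_def)

section \<open>Circle means and the submean inequality\<close>

lemma emeasure_circle_measure: "emeasure circle_measure (space circle_measure) = 1"
  by (simp add: emeasure_lborel_Icc_eq)

lemma sigma_finite_circle_measure: "sigma_finite_measure circle_measure"
  by (intro finite_measure.axioms(1) finite_measureI)
    (simp add: emeasure_lborel_Icc_eq)

lemma continuous_on_vector_scalar_mult:
  fixes f :: "'a::topological_space \<Rightarrow> complex" and g :: "'a \<Rightarrow> complex^'n"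
  assumes "continuous_on S f" "continuous_on S g"
  shows "continuous_on S (\<lambda>x. f x *s g x)"
  unfolding vector_scalar_mult_def by (intro continuous_intros assms)

lemma measurable_depth_circle:
  assumes "open D" "usc_on D u"
  shows "(\<lambda>t. depth D u (z + cis t *s w)) \<in> borel_measurable borel"
  by (intro measurable_compose[OF _ borel_measurable_depth[OF assms]] borel_measurable_continuous_onI
        continuous_on_vector_scalar_mult continuous_on_cis continuous_intros)

text \<open>On the circle the positive part of \<open>u\<close> vanishes and the negative part is
  \<open>depth\<close>, so only one of the two integrals remains.\<close>

lemma circle_mean_eq_disc_mean:
  assumes D: "open D" "usc_on D u" and neg: "\<And>x. x \<in> D \<Longrightarrow> u x \<le> 0"
    and disc: "\<And>t. z + (a + of_real r * cis t) *s w \<in> D"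
  shows "circle_mean (\<lambda>\<zeta>. u (z + \<zeta> *s w)) a r
    = - enn2ereal (disc_mean D u (z + a *s w) (of_real r *s w))"
proof -
  have pt: "z + a *s w + cis t *s (of_real r *s w) = z + (a + of_real r * cis t) *s w" for t
    by (simp add: vec_eq_iff algebra_simps)
  have 1: "e2ennreal (u (z + (a + of_real r * cis t) *s w)) = 0" for t
    by (rule e2ennreal_neg[OF neg[OF disc]])
  have depth_eq: "depth D u (z + (a + of_real r * cis t) *s w)
      = e2ennreal (- u (z + (a + of_real r * cis t) *s w))" for t
    unfolding depth_def by (rule if_P[OF disc])
  have meas: "(\<lambda>t. depth D u (z + a *s w + cis t *s (of_real r *s w))) \<in> borel_measurable borel"
    by (rule measurable_depth_circle[OF D])
  have "disc_mean D u (z + a *s w) (of_real r *s w) =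
      (\<integral>\<^sup>+t\<in>{0..2*pi}. depth D u (z + a *s w + cis t *s (of_real r *s w)) \<partial>lborel)
        / emeasure lborel {0..2*pi}"
    unfolding disc_mean_def
    by (rule nn_integral_uniform_measure) (use meas in \<open>simp only: measurable_lborel2\<close>, simp)
  also have "\<dots> = ennreal (1 / (2 * pi)) *
      (\<integral>\<^sup>+t\<in>{0..2*pi}. e2ennreal (- u (z + (a + of_real r * cis t) *s w)) \<partial>lborel)"
    unfolding pt depth_eq
    by (simp add: emeasure_lborel_Icc_eq divide_ennreal_def inverse_ennreal field_simps)
  finally have mean: "disc_mean D u (z + a *s w) (of_real r *s w) = \<dots>" .
  show ?thesis
    unfolding circle_mean_def mean 1
    by (simp add: times_ennreal.rep_eq zero_ennreal.rep_eq)
qed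

text \<open>The working form of plurisubharmonicity: slices, centres and radii collapse into one
  submean inequality per embedded disc, and finiteness from above is automatic.\<close>

lemma psh_on_nonpos_iff:
  fixes u :: "complex^'n \<Rightarrow> ereal"
  assumes D: "open D" and neg: "\<And>x. x \<in> D \<Longrightarrow> u x \<le> 0"
  shows "psh_on D u \<longleftrightarrow> usc_on D u \<and>
    (\<forall>z w. (\<forall>\<zeta>\<in>cball 0 1. z + \<zeta> *s w \<in> D) \<longrightarrow> u z \<le> - enn2ereal (disc_mean D u z w))"
proof (intro iffI conjI allI impI)
  assume u: "psh_on D u"
  then show usc: "usc_on D u" by (simp add: psh_on_def)
  fix z w assume disc: "\<forall>\<zeta>\<in>cball 0 1. z + \<zeta> *s w \<in> D"
  then have "u (z + 0 *s w) \<le> circle_mean (\<lambda>\<zeta>. u (z + \<zeta> *s w)) 0 1"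
    using u[unfolded psh_on_def subharmonic_on_def, THEN conjunct2, THEN conjunct2, rule_format,
        of z w, THEN conjunct2, THEN conjunct2, rule_format, of 1 0] by auto
  moreover have "z + (0 + of_real 1 * cis t) *s w \<in> D" for t
    using disc by simp
  ultimately show "u z \<le> - enn2ereal (disc_mean D u z w)"
    using circle_mean_eq_disc_mean[OF D usc neg, of z 0 1 w] by simp
next
  assume R: "usc_on D u \<and>
    (\<forall>z w. (\<forall>\<zeta>\<in>cball 0 1. z + \<zeta> *s w \<in> D) \<longrightarrow> u z \<le> - enn2ereal (disc_mean D u z w))"
  show "psh_on D u"
    unfolding psh_on_def subharmonic_on_def
  proof (intro conjI allI ballI impI)
    show "usc_on D u" using R by simp
    show "u z < \<infinity>" if "z \<in> D" for z
      using neg[OF that] by (auto simp: less_top[symmetric])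
    fix z w :: "complex^'n"
    let ?S = "{\<zeta>. z + \<zeta> *s w \<in> D}"
    have cont: "continuous_on UNIV (\<lambda>\<zeta>. z + \<zeta> *s w)"
      by (intro continuous_on_vector_scalar_mult continuous_intros)
    then have "open ?S"
      using open_vimage[OF D] by (simp add: vimage_def)
    moreover have "open {\<zeta> \<in> ?S. u (z + \<zeta> *s w) < c}" for c
    proof -
      have "open {x \<in> D. u x < c}"
        using R D by (simp add: usc_on_iff_open_sublevel)
      from open_vimage[OF this cont] show ?thesis by (simp add: vimage_def)
    qed
    ultimately show "usc_on ?S (\<lambda>\<zeta>. u (z + \<zeta> *s w))"
      by (simp add: usc_on_iff_open_sublevel)
    show "u (z + \<zeta> *s w) < \<infinity>" if "\<zeta> \<in> ?S" for \<zeta>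
      using neg[of "z + \<zeta> *s w"] that by (auto simp: less_top[symmetric])
    fix a r assume ar: "0 < r \<and> cball a r \<subseteq> ?S"
    \<comment> \<open>Centre \<open>a\<close> and radius \<open>r\<close> in the slice are traded
      for the base point z + a w and the direction r w.\<close>
    have "z + a *s w + \<zeta> *s (of_real r *s w) \<in> D" if "\<zeta> \<in> cball 0 1" for \<zeta>
    proof -
      have "a + of_real r * \<zeta> \<in> cball a r"
        using ar that by (simp add: dist_norm norm_mult mult_left_le)
      with ar have "z + (a + of_real r * \<zeta>) *s w \<in> D" by auto
      also have "z + (a + of_real r * \<zeta>) *s w = z + a *s w + \<zeta> *s (of_real r *s w)"
        by (simp add: vec_eq_iff algebra_simps)
      finally show ?thesis .
    qed
    with R have "u (z + a *s w) \<le> - enn2ereal (disc_mean D u (z + a *s w) (of_real r *s w))"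
      by blast
    also have "\<dots> = circle_mean (\<lambda>\<zeta>. u (z + \<zeta> *s w)) a r"
    proof (rule circle_mean_eq_disc_mean[OF D _ neg, symmetric])
      show "z + (a + of_real r * cis t) *s w \<in> D" for t
      proof -
        have "a + of_real r * cis t \<in> cball a r"
          using ar by (simp add: dist_norm norm_mult)
        with ar show ?thesis by blast
      qed
    qed (use R in auto)
    finally show "u (z + a *s w) \<le> circle_mean (\<lambda>\<zeta>. u (z + \<zeta> *s w)) a r" .
  qed
qed

lemma psh_on_disc_mean:
  fixes u :: "complex^'n \<Rightarrow> ereal"
  assumes "psh_on D u" "open D" "\<And>x. x \<in> D \<Longrightarrow> u x \<le> 0"
    and "\<And>\<zeta>. cmod \<zeta> \<le> 1 \<Longrightarrow> z + \<zeta> *s w \<in> D"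
  shows "u z \<le> - enn2ereal (disc_mean D u z w)"
  using iffD1[OF psh_on_nonpos_iff[OF assms(2,3)] assms(1)] assms(4) by simp

lemma psh_on_nonposI:
  fixes u :: "complex^'n \<Rightarrow> ereal"
  assumes "open D" "usc_on D u" "\<And>x. x \<in> D \<Longrightarrow> u x \<le> 0"
    and "\<And>z w. (\<And>\<zeta>. cmod \<zeta> \<le> 1 \<Longrightarrow> z + \<zeta> *s w \<in> D) \<Longrightarrow> u z \<le> - enn2ereal (disc_mean D u z w)"
  shows "psh_on D u"
  using psh_on_nonpos_iff[OF assms(1,3)] assms(2,4) by simp

lemma disc_mean_le_liminf:
  assumes D: "open D" "usc_on D u" and lim: "X \<longlonglongrightarrow> z"
  shows "disc_mean D u z w \<le> liminf (\<lambda>n. disc_mean D u (X n) w)"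
proof -
  have "disc_mean D u z w \<le> (\<integral>\<^sup>+t. liminf (\<lambda>n. depth D u (X n + cis t *s w)) \<partial>circle_measure)"
    unfolding disc_mean_def
    by (intro nn_integral_mono depth_le_liminf D tendsto_add lim tendsto_const)
  also have "\<dots> \<le> liminf (\<lambda>n. disc_mean D u (X n) w)"
    unfolding disc_mean_def
    by (intro nn_integral_liminf) (simp add: uniform_measure_def measurable_depth_circle[OF D])
  finally show ?thesis .
qed

text \<open>
  Fatou's lemma makes circle means of \<open>usc_reg\<close> upper semicontinuous in the centre, so the
  submean inequality passes from the members of \<open>F\<close> to the regularized supremum.
\<close>

lemma psh_on_usc_reg_SUP:
  fixes F :: "(complex^'n \<Rightarrow> ereal) set"
  assumes D: "open D" and psh: "\<And>u. u \<in> F \<Longrightarrow> psh_on D u"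
    and neg: "\<And>u x. u \<in> F \<Longrightarrow> x \<in> D \<Longrightarrow> u x \<le> 0"
  defines "s \<equiv> usc_reg D (\<lambda>x. SUP u\<in>F. u x)"
  shows "psh_on D s" "\<And>x. x \<in> D \<Longrightarrow> s x \<le> 0"
proof -
  have "usc_on D (\<lambda>x. 0)" by (simp add: usc_on_def)
  then show s_neg: "s x \<le> 0" if "x \<in> D" for x
    unfolding s_def using that neg by (intro usc_reg_le[OF D]) (auto intro: SUP_least)
  have usc: "usc_on D s"
    unfolding s_def by (rule usc_on_usc_reg[OF D])
  show "psh_on D s"
  proof (rule psh_on_nonposI[OF D usc s_neg])
    fix z w :: "complex^'n" assume disc: "\<And>\<zeta>. cmod \<zeta> \<le> 1 \<Longrightarrow> z + \<zeta> *s w \<in> D"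
    \<comment> \<open>The closed disc is compact in \<open>D\<close>, so it has a collar of width
      \<open>e\<close>; its translates to centres \<open>x\<close> within \<open>e\<close> of
      \<open>z\<close> stay in \<open>D\<close>.\<close>
    define K where "K = (\<lambda>\<zeta>. z + \<zeta> *s w) ` cball 0 1"
    have "compact K"
      unfolding K_def
      by (intro compact_continuous_image continuous_on_vector_scalar_mult continuous_intros) simp
    moreover have "K \<subseteq> D" using disc by (auto simp: K_def)
    ultimately obtain e where e: "e > 0" "(\<Union>x\<in>K. ball x e) \<subseteq> D"
      using compact_subset_open_imp_ball_epsilon_subset[OF _ D] by metis
    \<comment> \<open>Each \<open>u\<close> satisfies the submean inequality at \<open>x\<close>,
      and u \<le> s makes the mean of \<open>s\<close> a weaker bound common to all members.\<close>
    have le: "(SUP u\<in>F. u x) \<le> - enn2ereal (disc_mean D s x w)" if "dist z x < e" for x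
    proof (rule SUP_least)
      fix u assume u: "u \<in> F"
      have "x + \<zeta> *s w \<in> D" if "cmod \<zeta> \<le> 1" for \<zeta>
      proof -
        have "x + \<zeta> *s w \<in> ball (z + \<zeta> *s w) e"
          using \<open>dist z x < e\<close> by simp
        moreover have "z + \<zeta> *s w \<in> K" unfolding K_def using that by (intro imageI) simp
        ultimately show ?thesis using e(2) by blast
      qed
      then have "u x \<le> - enn2ereal (disc_mean D u x w)"
        by (intro psh_on_disc_mean psh[OF u] D neg[OF u])
      also have "\<dots> \<le> - enn2ereal (disc_mean D s x w)"
      proof -
        have "u y \<le> s y" if "y \<in> D" for y
          unfolding s_def by (rule order_trans[OF SUP_upper[OF u] le_usc_reg[OF that]])
        then have "disc_mean D s x w \<le> disc_mean D u x w"
          unfolding disc_mean_def by (intro nn_integral_mono depth_antimono)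
        then show ?thesis by (simp add: less_eq_ennreal.rep_eq)
      qed
      finally show "u x \<le> - enn2ereal (disc_mean D s x w)" .
    qed
    have "s z \<le> c" if c: "- enn2ereal (disc_mean D s z w) < c" for c
    proof -
      \<comment> \<open>Testing along sequences makes the Fatou estimate
        \<open>disc_mean_le_liminf\<close> applicable.\<close>
      have "\<forall>\<^sub>F x in inf (nhds z) (principal D). (SUP u\<in>F. u x) \<le> c"
        unfolding eventually_nhds_within_iff_sequentially
      proof safe
        fix X assume X: "\<forall>n. X n \<in> D" "X \<longlonglongrightarrow> z"
        \<comment> \<open>For c \<ge> 0 truncation gives \<open>e2ennreal (- c) = 0\<close>, and the
          strict inequality may fail; there nonpositivity of the family suffices.\<close>
        have "e2ennreal (- c) < disc_mean D s z w \<or> c \<ge> 0"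
          using c
          by (metis enn2ereal_e2ennreal ereal_uminus_le_0_iff ereal_uminus_less_reorder less_ennreal.rep_eq linear
                ereal_0_le_uminus_iff)
        then have "\<forall>\<^sub>F n in sequentially. e2ennreal (- c) < disc_mean D s (X n) w \<or> c \<ge> 0"
          using less_LiminfD[OF less_le_trans[OF _ disc_mean_le_liminf[OF D usc X(2)]]] by auto
        moreover have "\<forall>\<^sub>F n in sequentially. dist (X n) z < e"
          using X(2) e(1) by (rule tendstoD)
        ultimately show "\<forall>\<^sub>F n in sequentially. (SUP u\<in>F. u (X n)) \<le> c"
        proof eventually_elim
          case (elim n)
          show ?case
          proof (cases "c \<ge> 0")
            case True
            with X neg show ?thesis by (auto intro!: SUP_least intro: order_trans)
          next
            case False
            then have "- c < enn2ereal (disc_mean D s (X n) w)"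
              using elim(1) by (simp add: less_ennreal.rep_eq enn2ereal_e2ennreal)
            then have "- enn2ereal (disc_mean D s (X n) w) \<le> c"
              using ereal_uminus_less_reorder less_imp_le by blast
            then show ?thesis
              using le[of "X n"] elim(2) by (auto simp: dist_commute intro: order_trans)
          qed
        qed
      qed
      then show "s z \<le> c"
        unfolding s_def usc_reg_def
        by (cases "inf (nhds z) (principal D) = bot") (auto simp: Limsup_bounded bot_ereal_def)
    qed
    then show "s z \<le> - enn2ereal (disc_mean D s z w)"
      by (rule dense_ge)
  qed
qed

section \<open>Closure properties of nonpositive psh functions\<close>

text \<open>Since \<open>depth\<close> discards values off \<open>D\<close>, an envelope may be
  reset to the dummy -\<infinity> there.\<close>

lemma psh_on_cong_nonpos:
  fixes u v :: "complex^'n \<Rightarrow> ereal"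
  assumes D: "open D" and eq: "\<And>x. x \<in> D \<Longrightarrow> u x = v x" and neg: "\<And>x. x \<in> D \<Longrightarrow> v x \<le> 0"
    and v: "psh_on D v"
  shows "psh_on D u"
proof -
  have "{x \<in> D. u x < c} = {x \<in> D. v x < c}" for c
    using eq by auto
  then have usc: "usc_on D u \<longleftrightarrow> usc_on D v"
    by (simp add: usc_on_iff_open_sublevel D)
  have "depth D u = depth D v"
    using eq by (auto simp: depth_def)
  then have mean: "disc_mean D u z w = disc_mean D v z w" for z w
    by (simp add: disc_mean_def)
  show ?thesis
  proof (rule psh_on_nonposI[OF D])
    show "usc_on D u" using v usc by (simp add: psh_on_def)
    show "u x \<le> 0" if "x \<in> D" for x using neg[OF that] eq[OF that] by simp
    fix z w :: "complex^'n"
    assume disc: "\<And>\<zeta>. cmod \<zeta> \<le> 1 \<Longrightarrow> z + \<zeta> *s w \<in> D"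
    then have "z \<in> D" using disc[of 0] by simp
    moreover have "v z \<le> - enn2ereal (disc_mean D v z w)"
      by (rule psh_on_disc_mean[OF v D neg disc])
    ultimately show "u z \<le> - enn2ereal (disc_mean D u z w)"
      by (simp add: eq mean)
  qed
qed

text \<open>Additivity of \<open>depth\<close> makes \<open>disc_mean\<close> additive, so the two
  submean inequalities simply add.\<close>

lemma psh_on_add_nonpos:
  fixes u v :: "complex^'n \<Rightarrow> ereal"
  assumes D: "open D" and psh: "psh_on D u" "psh_on D v"
    and neg: "\<And>x. x \<in> D \<Longrightarrow> u x \<le> 0" "\<And>x. x \<in> D \<Longrightarrow> v x \<le> 0"
  shows "psh_on D (\<lambda>x. u x + v x)"
proof (rule psh_on_nonposI[OF D])
  show "u x + v x \<le> 0" if "x \<in> D" for x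
    using neg[OF that] by (rule add_nonpos_nonpos)
  have sum: "depth D (\<lambda>x. u x + v x) = (\<lambda>x. depth D u x + depth D v x)"
    by (intro ext depth_add neg)
  have usc: "usc_on D u" "usc_on D v" using psh by (auto simp: psh_on_def)
  then show "usc_on D (\<lambda>x. u x + v x)" by (rule usc_on_add_nonpos[OF D _ _ neg])
  show "u z + v z \<le> - enn2ereal (disc_mean D (\<lambda>x. u x + v x) z w)"
    if disc: "\<And>\<zeta>. cmod \<zeta> \<le> 1 \<Longrightarrow> z + \<zeta> *s w \<in> D" for z w
  proof -
    have "disc_mean D (\<lambda>x. u x + v x) z w = disc_mean D u z w + disc_mean D v z w"
      unfolding disc_mean_def sum
      by (rule nn_integral_add) (simp_all add: uniform_measure_def measurable_depth_circle[OF D] usc)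
    moreover have "u z \<le> - enn2ereal (disc_mean D u z w)" "v z \<le> - enn2ereal (disc_mean D v z w)"
      by (intro psh_on_disc_mean psh D neg disc; assumption)+
    then have "u z + v z \<le> - enn2ereal (disc_mean D u z w) + - enn2ereal (disc_mean D v z w)"
      by (rule add_mono)
    moreover have "- enn2ereal a + - enn2ereal b = - enn2ereal (a + b)" for a b
      by (cases a; cases b) (auto simp: plus_ennreal.rep_eq)
    ultimately show ?thesis by simp
  qed
qed

lemma psh_on_mult_nonpos:
  fixes u :: "complex^'n \<Rightarrow> ereal"
  assumes D: "open D" and psh: "psh_on D u" and neg: "\<And>x. x \<in> D \<Longrightarrow> u x \<le> 0" and k: "k > 0"
  shows "psh_on D (\<lambda>x. ereal k * u x)"
proof (rule psh_on_nonposI[OF D])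
  show "ereal k * u x \<le> 0" if "x \<in> D" for x
    using neg[OF that] k by (simp add: ereal_mult_le_0_iff)
  have mult: "depth D (\<lambda>x. ereal k * u x) = (\<lambda>x. ennreal k * depth D u x)"
    by (intro ext depth_mult k neg)
  have usc: "usc_on D u" using psh by (auto simp: psh_on_def)
  then show "usc_on D (\<lambda>x. ereal k * u x)" using k by (rule usc_on_mult_const[OF D])
  show "ereal k * u z \<le> - enn2ereal (disc_mean D (\<lambda>x. ereal k * u x) z w)"
    if disc: "\<And>\<zeta>. cmod \<zeta> \<le> 1 \<Longrightarrow> z + \<zeta> *s w \<in> D" for z w
  proof -
    have "disc_mean D (\<lambda>x. ereal k * u x) z w = ennreal k * disc_mean D u z w"
      unfolding disc_mean_def mult
      by (rule nn_integral_cmult) (simp add: uniform_measure_def measurable_depth_circle[OF D] usc)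
    moreover have "u z \<le> - enn2ereal (disc_mean D u z w)"
      by (rule psh_on_disc_mean[OF psh D neg disc])
    then have "ereal k * u z \<le> ereal k * - enn2ereal (disc_mean D u z w)"
      using k by (intro ereal_mult_left_mono) auto
    ultimately show ?thesis using k by (simp add: times_ennreal.rep_eq)
  qed
qed

section \<open>Ball means\<close>

lemma norm_vector_scalar_mult_complex:
  fixes w :: "complex^'n"
  shows "norm (c *s w) = cmod c * norm w"
  by (simp add: norm_vec_def norm_mult L2_set_right_distrib)

text \<open>Averages the disc inequality over all directions \<open>w\<close> in the ball. Rotation
  of \<open>w\<close> by \<open>cis t\<close> preserves Lebesgue measure, so the averaged circle
  means recover the ball integral. The inequality points downwards because \<open>depth\<close> is
  the negative of \<open>u\<close>.\<close>

lemma psh_ball_submean: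
  fixes u :: "complex^'n \<Rightarrow> ereal"
  assumes D: "open D" and psh: "psh_on D u" and neg: "\<And>x. x \<in> D \<Longrightarrow> u x \<le> 0"
    and ball: "ball z r \<subseteq> D"
  shows "(\<integral>\<^sup>+x\<in>ball z r. depth D u x \<partial>lborel)
    \<le> depth D u z * emeasure lborel (ball 0 r :: (complex^'n) set)"
proof -
  interpret sigma_finite_measure circle_measure by (rule sigma_finite_circle_measure)
  interpret pair_sigma_finite circle_measure "lborel :: (complex^'n) measure" ..
  have usc: "usc_on D u" using psh by (simp add: psh_on_def)
  note [measurable] = borel_measurable_depth[OF D usc]
  have [measurable]: "ball x r \<in> sets borel" for x :: "complex^'n" by simp
  let ?B = "ball 0 r :: (complex^'n) set"
  define f where "f w = depth D u (z + w) * indicator ?B w" for w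
  have [measurable]: "f \<in> borel_measurable borel" unfolding f_def by measurable
  have "(\<integral>\<^sup>+x\<in>ball z r. depth D u x \<partial>lborel) =
      (\<integral>\<^sup>+w. depth D u (z + w) * indicator (ball z r) (z + w) \<partial>lborel)"
    by (rule nn_integral_lborel_translate[symmetric]) measurable
  also have "\<dots> = (\<integral>\<^sup>+w. f w \<partial>lborel)"
    unfolding f_def by (intro nn_integral_cong) (auto simp: indicator_def dist_norm)
  \<comment> \<open>A dummy average over \<open>t\<close> is inserted at no cost, to be filled by
    rotating the inner variable.\<close>
  also have "\<dots> = (\<integral>\<^sup>+t. (\<integral>\<^sup>+w. f w \<partial>lborel) \<partial>circle_measure)"
    using emeasure_circle_measure by simp
  also have "\<dots> = (\<integral>\<^sup>+t. (\<integral>\<^sup>+w. depth D u (z + cis t *s w) * indicator ?B w \<partial>lborel) \<partial>circle_measure)"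
  proof (rule nn_integral_cong)
    fix t
    have "(\<integral>\<^sup>+w. f w \<partial>lborel) = (\<integral>\<^sup>+w. f (cis t *s w) \<partial>lborel)"
    proof (rule nn_integral_lborel_linear_isometry[symmetric])
      show "linear (\<lambda>w::complex^'n. cis t *s w)"
        by (rule linearI) (simp_all add: vec_eq_iff algebra_simps)
    qed (simp_all add: norm_vector_scalar_mult_complex)
    also have "\<dots> = (\<integral>\<^sup>+w. depth D u (z + cis t *s w) * indicator ?B w \<partial>lborel)"
      by (simp add: f_def indicator_def norm_vector_scalar_mult_complex)
    finally show "(\<integral>\<^sup>+w. f w \<partial>lborel) = (\<integral>\<^sup>+w. depth D u (z + cis t *s w) * indicator ?B w \<partial>lborel)" .
  qed
  also have "\<dots> = (\<integral>\<^sup>+w. (\<integral>\<^sup>+t. depth D u (z + cis t *s w) * indicator ?B w \<partial>circle_measure) \<partial>lborel)"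
  proof (rule Fubini'[symmetric])
    have "(\<lambda>p. z + cis (fst p) *s snd p) \<in> borel_measurable (borel :: (real \<times> (complex^'n)) measure)"
      by (intro borel_measurable_continuous_onI continuous_on_vector_scalar_mult
            continuous_on_cis continuous_intros)
    then have [measurable]: "(\<lambda>p. z + cis (fst p) *s snd p) \<in> borel_measurable (borel \<Otimes>\<^sub>M borel)"
      by (simp add: borel_prod)
    have "(\<lambda>p. depth D u (z + cis (fst p) *s snd p) * indicator ?B (snd p)) \<in> borel_measurable (borel \<Otimes>\<^sub>M borel)"
      by measurable
    moreover have "sets (circle_measure \<Otimes>\<^sub>M lborel) = sets (borel \<Otimes>\<^sub>M (borel :: (complex^'n) measure))"
      by (intro sets_pair_measure_cong) auto
    ultimately show "(\<lambda>(t, w). depth D u (z + cis t *s w) * indicator ?B w)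
        \<in> borel_measurable (circle_measure \<Otimes>\<^sub>M lborel)"
      by (simp add: case_prod_beta' cong: measurable_cong_sets)
  qed
  also have "\<dots> = (\<integral>\<^sup>+w\<in>?B. disc_mean D u z w \<partial>lborel)"
    unfolding disc_mean_def
    by (intro nn_integral_cong nn_integral_multc)
      (simp add: uniform_measure_def measurable_depth_circle[OF D usc])
  also have "\<dots> \<le> (\<integral>\<^sup>+w\<in>?B. depth D u z \<partial>lborel)"
  proof (intro nn_integral_mono)
    fix w :: "complex^'n"
    show "disc_mean D u z w * indicator ?B w \<le> depth D u z * indicator ?B w"
    proof (cases "w \<in> ?B")
      case True
      then have "z + \<zeta> *s w \<in> D" if "cmod \<zeta> \<le> 1" for \<zeta>
        using that ball mult_right_mono[of "cmod \<zeta>" 1 "norm w"]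
        by (auto simp: subset_eq dist_norm norm_vector_scalar_mult_complex)
      then have "u z \<le> - enn2ereal (disc_mean D u z w)"
        by (intro psh_on_disc_mean psh D neg)
      then have "enn2ereal (disc_mean D u z w) \<le> - u z"
        using ereal_minus_le_minus[of "- enn2ereal (disc_mean D u z w)" "u z"] by simp
      \<comment> \<open>Some \<open>w\<close> in the ball forces r > 0, hence \<open>z\<close> lies
        in its own ball; an empty ball needs no separate treatment.\<close>
      moreover have "z \<in> D"
        using True ball by (auto intro!: subsetD[OF ball] le_less_trans[OF norm_ge_zero])
      ultimately show ?thesis
        using e2ennreal_mono[of "enn2ereal (disc_mean D u z w)" "- u z"] True by (simp add: depth_def)
    qed simp
  qed
  also have "\<dots> = depth D u z * emeasure lborel ?B"
    by (simp add: nn_integral_cmult_indicator)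
  finally show ?thesis .
qed

text \<open>
  The ball mean of a nonpositive psh function that is close to 0 somewhere near \<open>z\<close> is close to 0;
  this replaces the usual argument through the negligible set where a supremum of psh functions
  differs from its regularization.
\<close>

lemma le_of_add_family_le:
  fixes h Q :: "complex^'n \<Rightarrow> ereal"
  assumes D: "open D" and h: "psh_on D h" "\<And>x. x \<in> D \<Longrightarrow> h x \<le> 0"
    and F: "\<And>w. w \<in> F \<Longrightarrow> psh_on D w" "\<And>w x. w \<in> F \<Longrightarrow> x \<in> D \<Longrightarrow> w x \<le> 0"
    and F0: "usc_reg D (\<lambda>x. SUP w\<in>F. w x) z = 0"
    and Q: "usc_on D Q" and le: "\<And>w x. w \<in> F \<Longrightarrow> x \<in> D \<Longrightarrow> h x + w x \<le> Q x"
    and z: "z \<in> D"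
  shows "h z \<le> Q z"
proof (rule ccontr)
  assume "\<not> h z \<le> Q z"
  then obtain c where c: "Q z < ereal c" "ereal c < h z"
    using ereal_dense2 by (metis not_le)
  \<comment> \<open>Here h z is finite: it lies above the real \<open>c\<close> and is at most 0.
    The gap -c - a > 0 drives the contradiction.\<close>
  then obtain a where a: "h z = ereal (- a)" "0 \<le> a" "a < - c"
    using h(2)[OF z] by (cases "h z") (auto intro: that[of "- real_of_ereal (h z)"])
  have "open {x \<in> D. Q x < ereal c}"
    using Q D by (simp add: usc_on_iff_open_sublevel)
  then obtain R where R: "R > 0" "ball z R \<subseteq> {x \<in> D. Q x < ereal c}"
    using c(1) z by (metis (mono_tags, lifting) mem_Collect_eq openE)
  define vol where "vol r = unit_ball_vol (real DIM(complex^'n)) * r ^ DIM(complex^'n)" for r :: real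
  define b b' where "b = vol (R/3)" and "b' = vol (2*R/3)"
  have vol: "emeasure lborel (ball x (R/3)) = ennreal b"
      "emeasure lborel (ball x (2*R/3)) = ennreal b'" for x :: "complex^'n"
    unfolding b_def b'_def vol_def
    using R(1) emeasure_ball[of "R/3" x] emeasure_ball[of "2*R/3" x] by simp_all
  have b: "b > 0" "b' > 0"
    unfolding b_def b'_def vol_def using R(1) by simp_all
  \<comment> \<open>Chosen so that \<open>e * b'\<close> is half of \<open>(- c - a) * b\<close>,
    which leaves part of the gap uncovered.\<close>
  define e where "e = (- c - a) * b / (2 * b')"
  have "e > 0" using a b by (simp add: e_def)
  let ?B = "ball z (R/3)"
  \<comment> \<open>A regularized supremum equal to 0 at \<open>z\<close> cannot stay below -e near
    \<open>z\<close>; this yields a member \<open>w\<close> with w x > -e at some nearby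
    \<open>x\<close>.\<close>
  have "\<not> (\<forall>x\<in>?B \<inter> D. (SUP w\<in>F. w x) \<le> ereal (- e))"
  proof
    assume "\<forall>x\<in>?B \<inter> D. (SUP w\<in>F. w x) \<le> ereal (- e)"
    then have "usc_reg D (\<lambda>x. SUP w\<in>F. w x) z < 0"
      using \<open>e > 0\<close> R(1) unfolding usc_reg_less_iff
      by (intro exI[of _ "ereal (- e)"] exI[of _ ?B] conjI) auto
    with F0 show False by simp
  qed
  then obtain x w where x: "x \<in> ?B" "x \<in> D" and w: "w \<in> F" "ereal (- e) < w x"
    by (auto simp: not_le less_SUP_iff)
  \<comment> \<open>The bound on \<open>w\<close> is known at \<open>x\<close>, so its submean
    inequality is centred there. Radius 2R/3 covers \<open>?B\<close>, since x is within R/3 of z,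
    and stays inside \<open>ball z R\<close>.\<close>
  have "?B \<subseteq> ball x (2*R/3)"
  proof
    fix y assume "y \<in> ?B"
    with x dist_triangle2[of x y z] show "y \<in> ball x (2*R/3)"
      by (simp add: dist_commute)
  qed
  moreover have sub: "ball x (2*R/3) \<subseteq> D"
  proof
    fix y assume "y \<in> ball x (2*R/3)"
    with x dist_triangle[of z y x] have "y \<in> ball z R" by simp
    with R show "y \<in> D" by blast
  qed
  ultimately have "(\<integral>\<^sup>+y\<in>?B. depth D w y \<partial>lborel) \<le> (\<integral>\<^sup>+y\<in>ball x (2*R/3). depth D w y \<partial>lborel)"
    by (intro nn_integral_mono mult_left_mono) (auto simp: indicator_def)
  also have "\<dots> \<le> depth D w x * ennreal b'"
    using psh_ball_submean[OF D F(1)[OF w(1)] F(2)[OF w(1)] sub] vol by simp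
  also have "depth D w x \<le> ennreal e"
    using w(2) x(2) e2ennreal_mono[of "- w x" "ereal e"]
    by (simp add: depth_def ereal_uminus_le_reorder less_imp_le)
  finally have w_mean: "(\<integral>\<^sup>+y\<in>?B. depth D w y \<partial>lborel) \<le> ennreal e * ennreal b'"
    by (simp add: mult_right_mono)
  have "ball z (R/3) \<subseteq> ball z R" using R(1) by (intro subset_ball) simp
  with R have subB: "?B \<subseteq> {x \<in> D. Q x < ereal c}" by blast
  then have "(\<integral>\<^sup>+y\<in>?B. depth D h y \<partial>lborel) \<le> depth D h z * ennreal b"
    using psh_ball_submean[OF D h, of z "R/3"] vol by auto
  also have "depth D h z = ennreal a" using z a by (simp add: depth_def)
  finally have h_mean: "(\<integral>\<^sup>+y\<in>?B. depth D h y \<partial>lborel) \<le> ennreal a * ennreal b" .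
  have [measurable]: "?B \<in> sets borel" by simp
  have [measurable]: "depth D h \<in> borel_measurable borel" "depth D w \<in> borel_measurable borel"
    using h(1) F(1)[OF w(1)] by (auto intro!: borel_measurable_depth D simp: psh_on_def)
  \<comment> \<open>On \<open>?B\<close> the sum h + w is at most Q < c, so the depths of
    \<open>h\<close> and \<open>w\<close> together are at least -c; integration compares this with
    the two mean bounds.\<close>
  have "ennreal (- c) * ennreal b = (\<integral>\<^sup>+y\<in>?B. ennreal (- c) \<partial>lborel)"
    by (simp add: nn_integral_cmult_indicator vol(1))
  also have "\<dots> \<le> (\<integral>\<^sup>+y. depth D h y * indicator ?B y + depth D w y * indicator ?B y \<partial>lborel)"
  proof (intro nn_integral_mono)
    fix y
    show "ennreal (- c) * indicator ?B y \<le> depth D h y * indicator ?B y + depth D w y * indicator ?B y"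
    proof (cases "y \<in> ?B")
      case True
      with subB have y: "y \<in> D" "Q y < ereal c" by auto
      then have "h y + w y \<le> ereal c" using le[OF w(1) y(1)] by simp
      then have "ereal (- c) \<le> - (h y + w y)"
        using ereal_minus_le_minus[of "ereal c" "h y + w y"] by simp
      then have "ennreal (- c) \<le> depth D (\<lambda>x. h x + w x) y"
        using y(1) e2ennreal_mono[of "ereal (- c)" "- (h y + w y)"] by (simp add: depth_def)
      also have "\<dots> = depth D h y + depth D w y"
        using h(2) F(2)[OF w(1)] by (rule depth_add)
      finally show ?thesis using True by simp
    qed simp
  qed
  also have "\<dots> = (\<integral>\<^sup>+y\<in>?B. depth D h y \<partial>lborel) + (\<integral>\<^sup>+y\<in>?B. depth D w y \<partial>lborel)"
    by (rule nn_integral_add) measurable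
  also have "\<dots> \<le> ennreal a * ennreal b + ennreal e * ennreal b'"
    by (intro add_mono h_mean w_mean)
  also have "\<dots> = ennreal (a * b + e * b')"
    using a b \<open>e > 0\<close> by (simp add: ennreal_mult)
  also have "ennreal (- c) * ennreal b = ennreal ((- c) * b)"
    using a b by (intro ennreal_mult[symmetric]) auto
  finally have "- c * b \<le> a * b + e * b'"
    using a b \<open>e > 0\<close> by (subst (asm) ennreal_le_iff) auto
  moreover have "e * b' = (- c - a) * b / 2" using b by (simp add: e_def)
  moreover have "(- c - a) * b > 0" using a b by simp
  ultimately show False by (simp add: algebra_simps)
qed

section \<open>Rooftop envelopes\<close>

text \<open>The regularized supremum of all psh minorants is psh, and it remains a minorant because
  the minimum is itself usc. This shows that the definite description in \<open>rooftop\<close>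
  denotes.\<close>

lemma largest_psh_minorant_rooftop:
  fixes D :: "(complex^'n) set"
  assumes D: "open D" and usc: "usc_on D u" "usc_on D v" and neg: "\<And>x. x \<in> D \<Longrightarrow> u x \<le> 0"
  shows "largest_psh_minorant D (\<lambda>z. min (u z) (v z)) (rooftop D u v)"
proof -
  define F where "F = {w. psh_on D w \<and> (\<forall>z\<in>D. w z \<le> min (u z) (v z))}"
  define s where "s = usc_reg D (\<lambda>x. SUP w\<in>F. w x)"
  define p where "p x = (if x \<in> D then s x else -\<infinity>)" for x
  have F_psh: "psh_on D w" and F_neg: "x \<in> D \<Longrightarrow> w x \<le> 0" if "w \<in> F" for w x
    using that neg[of x] by (auto simp: F_def intro: order_trans)
  have s: "psh_on D s" "\<And>x. x \<in> D \<Longrightarrow> s x \<le> 0"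
    unfolding s_def using F_psh F_neg by (intro psh_on_usc_reg_SUP D; blast)+
  have "psh_on D p"
    by (rule psh_on_cong_nonpos[OF D _ s(2) s(1)]) (simp_all add: p_def)
  moreover have "p z \<le> min (u z) (v z)" if "z \<in> D" for z
  proof -
    have "s z \<le> min (u z) (v z)"
      unfolding s_def by (rule usc_reg_le[OF D usc_on_min[OF D usc] _ that])
        (auto simp: F_def intro!: SUP_least)
    with that show ?thesis by (simp add: p_def)
  qed
  moreover have "w z \<le> p z" if "psh_on D w \<and> (\<forall>z\<in>D. w z \<le> min (u z) (v z))" "z \<in> D" for w z
  proof -
    have "w z \<le> (SUP w\<in>F. w z)" using that by (intro SUP_upper) (simp add: F_def)
    also have "\<dots> \<le> s z" unfolding s_def by (rule le_usc_reg[OF that(2)])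
    finally show ?thesis using that(2) by (simp add: p_def)
  qed
  ultimately have p: "largest_psh_minorant D (\<lambda>z. min (u z) (v z)) p"
    by (auto simp: largest_psh_minorant_def)
  have "rooftop D u v = p"
    using p by (rule rooftop_eqI) (simp add: p_def)
  with p show ?thesis by simp
qed

section \<open>The Green-Poisson function\<close>

lemma green_poisson_psh:
  fixes D :: "(complex^'n) set"
  assumes "open D"
  shows "psh_on D (green_poisson D \<phi>)" "x \<in> D \<Longrightarrow> green_poisson D \<phi> x \<le> 0"
proof -
  let ?F = "{w \<in> PSH_neg D. \<exists>C::real. \<forall>x\<in>D. w x \<le> \<phi> x + ereal C}"
  have F: "psh_on D w" "y \<in> D \<Longrightarrow> w y \<le> 0" if "w \<in> ?F" for w y
    using that by (auto simp: PSH_neg_def)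
  show "psh_on D (green_poisson D \<phi>)"
    unfolding green_poisson_def by (intro psh_on_usc_reg_SUP(1) assms F)
  show "green_poisson D \<phi> x \<le> 0" if "x \<in> D"
    unfolding green_poisson_def by (intro psh_on_usc_reg_SUP(2) assms F that)
qed

lemma le_green_poisson:
  assumes "psh_on D m" "\<And>x. x \<in> D \<Longrightarrow> m x \<le> 0" "\<And>x. x \<in> D \<Longrightarrow> m x \<le> \<phi> x + ereal C" "z \<in> D"
  shows "m z \<le> green_poisson D \<phi> z"
\<comment> \<open>\<open>PSH_neg\<close> excludes the constant -\<infinity>; a value m z other than
  -\<infinity> is itself the witness that \<open>m\<close> qualifies.\<close>
proof (cases "m z = -\<infinity>")
  case False
  with assms have "m \<in> {w \<in> PSH_neg D. \<exists>C::real. \<forall>x\<in>D. w x \<le> \<phi> x + ereal C}"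
    by (auto simp: PSH_neg_def)
  then have "m z \<le> (SUP w\<in>{w \<in> PSH_neg D. \<exists>C::real. \<forall>x\<in>D. w x \<le> \<phi> x + ereal C}. w z)"
    by (rule SUP_upper)
  also have "\<dots> \<le> green_poisson D \<phi> z"
    unfolding green_poisson_def by (rule le_usc_reg[OF assms(4)])
  finally show ?thesis .
qed simp

section \<open>The two inequalities between the asymptotic and the ordinary rooftop\<close>

context
  fixes D :: "(complex^'n) set" and \<phi> \<psi> :: "complex^'n \<Rightarrow> ereal"
  assumes D: "open D" and \<phi>: "\<phi> \<in> PSH_neg D" and \<psi>: "\<psi> \<in> PSH_neg D"
begin

text \<open>\<phi> + C may be positive; the sign of \<psi> alone keeps the minimum
  nonpositive.\<close>

lemma rooftop_shift:
  "largest_psh_minorant D (\<lambda>z. min (\<psi> z) (\<phi> z + ereal C)) (rooftop D \<psi> (\<lambda>x. \<phi> x + ereal C))"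
  using \<phi> \<psi> by (intro largest_psh_minorant_rooftop usc_on_add_const D) (auto simp: PSH_neg_def psh_on_def)

lemma rooftop_green_poisson:
  "largest_psh_minorant D (\<lambda>z. min (\<psi> z) (green_poisson D \<phi> z)) (rooftop D \<psi> (green_poisson D \<phi>))"
  using \<psi> green_poisson_psh(1)[OF D, of \<phi>]
  by (intro largest_psh_minorant_rooftop D) (auto simp: PSH_neg_def psh_on_def)

lemma usc_on_asymptotic_rooftop: "usc_on D (asymptotic_rooftop D \<phi> \<psi>)"
  unfolding asymptotic_rooftop_def by (rule usc_on_usc_reg[OF D])

text \<open>Lower bounds reduce to exhibiting a psh function \<open>m\<close>, with a constant
  \<open>C\<close> that may depend on it.\<close>

lemma le_asymptotic_rooftop:
  assumes "psh_on D m" "\<And>x. x \<in> D \<Longrightarrow> m x \<le> \<psi> x" "\<And>x. x \<in> D \<Longrightarrow> m x \<le> \<phi> x + ereal C" "z \<in> D"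
  shows "m z \<le> asymptotic_rooftop D \<phi> \<psi> z"
proof -
  have "m z \<le> rooftop D \<psi> (\<lambda>x. \<phi> x + ereal C) z"
    using rooftop_shift[of C] assms unfolding largest_psh_minorant_def by simp
  also have "\<dots> \<le> (SUP C::real. rooftop D \<psi> (\<lambda>x. \<phi> x + ereal C) z)"
    by (rule SUP_upper) simp
  also have "\<dots> \<le> asymptotic_rooftop D \<phi> \<psi> z"
    unfolding asymptotic_rooftop_def by (rule le_usc_reg[OF assms(4)])
  finally show ?thesis .
qed

text \<open>The minimum of \<psi> and \<open>g\<^sub>\<phi>\<close> is usc, so the common bound on
  all P(\<psi>, \<phi> + C) survives regularization, and the result is a psh minorant.\<close>

lemma asymptotic_rooftop_le:
  assumes z: "z \<in> D"
  shows "asymptotic_rooftop D \<phi> \<psi> z \<le> rooftop D \<psi> (green_poisson D \<phi>) z"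
proof -
  let ?r = "\<lambda>C::real. rooftop D \<psi> (\<lambda>x. \<phi> x + ereal C)"
  have r: "psh_on D (?r C)" "x \<in> D \<Longrightarrow> ?r C x \<le> \<psi> x" "x \<in> D \<Longrightarrow> ?r C x \<le> \<phi> x + ereal C" for C x
    using rooftop_shift[of C] by (auto simp: largest_psh_minorant_def)
  have r_neg: "?r C x \<le> 0" if "x \<in> D" for C x
    using r(2)[OF that, of C] \<psi> that by (auto simp: PSH_neg_def intro: order_trans)
  have A: "asymptotic_rooftop D \<phi> \<psi> = usc_reg D (\<lambda>x. SUP u\<in>range ?r. u x)"
    unfolding asymptotic_rooftop_def by (simp add: image_image)
  have "psh_on D (asymptotic_rooftop D \<phi> \<psi>)"
    unfolding A by (rule psh_on_usc_reg_SUP[OF D]) (use r(1) r_neg in auto)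
  moreover have "asymptotic_rooftop D \<phi> \<psi> x \<le> min (\<psi> x) (green_poisson D \<phi> x)" if "x \<in> D" for x
    unfolding asymptotic_rooftop_def
  proof (rule usc_reg_le[OF D _ _ that])
    show "usc_on D (\<lambda>x. min (\<psi> x) (green_poisson D \<phi> x))"
      using \<psi> green_poisson_psh(1)[OF D, of \<phi>]
      by (intro usc_on_min D) (auto simp: PSH_neg_def psh_on_def)
    show "(SUP C::real. ?r C x) \<le> min (\<psi> x) (green_poisson D \<phi> x)" if "x \<in> D" for x
    proof (intro SUP_least min.boundedI r(2) that)
      show "?r C x \<le> green_poisson D \<phi> x" for C
        by (rule le_green_poisson[OF r(1) r_neg r(3) that])
    qed
  qed
  ultimately show ?thesis
    using rooftop_green_poisson z unfolding largest_psh_minorant_def by blast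
qed

text \<open>If v \<le> w + C with v \<le> 0, then h + v lies below \<psi> and below
  \<open>g\<^sub>\<phi> + w + C\<close>, hence below \<phi> + C. Such \<open>v\<close> form the
  family defining \<open>g\<^sub>w\<close>, so \<open>le_of_add_family_le\<close> removes
  \<open>v\<close>.\<close>

lemma rooftop_le_of_green_poisson_zero:
  assumes w: "w \<in> PSH_neg D" "\<And>x. x \<in> D \<Longrightarrow> green_poisson D \<phi> x + w x \<le> \<phi> x"
    and w0: "\<And>x. x \<in> D \<Longrightarrow> green_poisson D w x = 0" and z: "z \<in> D"
  shows "rooftop D \<psi> (green_poisson D \<phi>) z \<le> asymptotic_rooftop D \<phi> \<psi> z"
proof -
  define h where "h = rooftop D \<psi> (green_poisson D \<phi>)"
  have h: "psh_on D h" "\<And>x. x \<in> D \<Longrightarrow> h x \<le> \<psi> x" "\<And>x. x \<in> D \<Longrightarrow> h x \<le> green_poisson D \<phi> x"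
    using rooftop_green_poisson by (auto simp: largest_psh_minorant_def h_def)
  have h_neg: "h x \<le> 0" if "x \<in> D" for x
    using h(2)[OF that] \<psi> that by (auto simp: PSH_neg_def intro: order_trans)
  define F where "F = {v \<in> PSH_neg D. \<exists>C::real. \<forall>x\<in>D. v x \<le> w x + ereal C}"
  have F: "psh_on D v" "x \<in> D \<Longrightarrow> v x \<le> 0" if "v \<in> F" for v x
    using that by (auto simp: F_def PSH_neg_def)
  have "h x + v x \<le> asymptotic_rooftop D \<phi> \<psi> x" if v: "v \<in> F" and x: "x \<in> D" for v x
  proof -
    obtain C :: real where C: "\<And>y. y \<in> D \<Longrightarrow> v y \<le> w y + ereal C"
      using v by (auto simp: F_def)
    show ?thesis
    proof (rule le_asymptotic_rooftop[OF _ _ _ x])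
      show "psh_on D (\<lambda>x. h x + v x)"
        by (intro psh_on_add_nonpos D h(1) F(1)[OF v] h_neg F(2)[OF v])
      show "h y + v y \<le> \<psi> y" if "y \<in> D" for y
        using add_mono[OF h(2) F(2)[OF v], OF that that] by simp
      show "h y + v y \<le> \<phi> y + ereal C" if "y \<in> D" for y
      proof -
        have "h y + v y \<le> green_poisson D \<phi> y + (w y + ereal C)"
          by (intro add_mono h(3) C that)
        also have "\<dots> = (green_poisson D \<phi> y + w y) + ereal C" by (simp add: add.assoc)
        also have "\<dots> \<le> \<phi> y + ereal C" by (intro add_mono w(2) that order_refl)
        finally show ?thesis .
      qed
    qed
  qed
  moreover have "usc_reg D (\<lambda>x. SUP v\<in>F. v x) z = 0"
    using w0[OF z] by (simp add: green_poisson_def F_def)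
  ultimately have "h z \<le> asymptotic_rooftop D \<phi> \<psi> z"
    using le_of_add_family_le[of D h F z "asymptotic_rooftop D \<phi> \<psi>"]
      D h(1) h_neg F usc_on_asymptotic_rooftop z by blast
  then show ?thesis by (simp add: h_def)
qed

text \<open>With k = 1/\<sigma>, multiplying
  \<open>h \<le> g\<^sub>\<phi> \<le> \<sigma> \<phi> + C\<close> by \<open>k\<close> gives k h
  \<le> \<phi> + k C, while k h \<le> h \<le> \<psi> because h \<le> 0.\<close>

lemma rooftop_le_of_approx_model_singularity:
  assumes model: "approx_model_singularity D \<phi>" and z: "z \<in> D"
  shows "rooftop D \<psi> (green_poisson D \<phi>) z \<le> asymptotic_rooftop D \<phi> \<psi> z"
proof -
  define h where "h = rooftop D \<psi> (green_poisson D \<phi>)"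
  have h: "psh_on D h" "\<And>x. x \<in> D \<Longrightarrow> h x \<le> \<psi> x" "\<And>x. x \<in> D \<Longrightarrow> h x \<le> green_poisson D \<phi> x"
    using rooftop_green_poisson by (auto simp: largest_psh_minorant_def h_def)
  have h_neg: "h x \<le> 0" if "x \<in> D" for x
    using h(2)[OF that] \<psi> that by (auto simp: PSH_neg_def intro: order_trans)
  have scaled: "ereal k * h z \<le> asymptotic_rooftop D \<phi> \<psi> z" if k: "k > 1" for k
  proof -
    obtain C :: real where C: "\<And>x. x \<in> D \<Longrightarrow> green_poisson D \<phi> x \<le> ereal (1 / k) * \<phi> x + ereal C"
      using model k unfolding approx_model_singularity_def
      by (metis divide_less_eq_1_pos zero_less_divide_1_iff zero_less_one less_trans)
    show ?thesis
    proof (rule le_asymptotic_rooftop[OF _ _ _ z])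
      show "psh_on D (\<lambda>x. ereal k * h x)"
        using k by (intro psh_on_mult_nonpos D h(1) h_neg) auto
      show "ereal k * h x \<le> \<psi> x" if "x \<in> D" for x
      proof -
        have "ereal k * h x \<le> h x"
          using h_neg[OF that] k by (cases "h x") (auto simp: mult_right_mono_neg[of 1 k, simplified])
        also have "\<dots> \<le> \<psi> x" by (rule h(2)[OF that])
        finally show ?thesis .
      qed
      show "ereal k * h x \<le> \<phi> x + ereal (k * C)" if "x \<in> D" for x
      proof -
        have "ereal k * h x \<le> ereal k * (ereal (1 / k) * \<phi> x + ereal C)"
          using k order_trans[OF h(3) C, OF that that] by (intro ereal_mult_left_mono) auto
        also have "\<dots> = \<phi> x + ereal (k * C)"
          using k by (cases "\<phi> x") (auto simp: distrib_left)
        finally show ?thesis .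
      qed
    qed
  qed
  show ?thesis
  proof (cases "h z")
    case (real r)
    show ?thesis
    proof (cases "asymptotic_rooftop D \<phi> \<psi> z")
      case (real a)
      have "r \<le> a"
      proof (rule ccontr)
        assume "\<not> r \<le> a"
        moreover have "r \<le> 0" using h_neg[OF z] \<open>h z = ereal r\<close> by simp
        \<comment> \<open>The value 0 is fixed by scaling, so this case is settled before dividing
          by \<open>r\<close>.\<close>
        moreover have "r \<noteq> 0" using scaled[of 2] \<open>h z = ereal r\<close> real \<open>\<not> r \<le> a\<close> by auto
        ultimately show False
          \<comment> \<open>As a < r < 0, this factor exceeds 1, and it maps \<open>r\<close> to the
            midpoint of \<open>a\<close> and \<open>r\<close>, which is above
            \<open>a\<close>.\<close>
          using scaled[of "(a / r + 1) / 2"] \<open>h z = ereal r\<close> real by (simp add: field_simps)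
      qed
      then show ?thesis using \<open>h z = ereal r\<close> real by (simp add: h_def)
    qed (use scaled[of 2] \<open>h z = ereal r\<close> in auto)
  qed (use h_neg[OF z] in \<open>auto simp: h_def\<close>)
qed

end

theorem proposition7p3:
  fixes D :: "(complex^'n) set" and \<phi> :: "complex^'n \<Rightarrow> ereal"
  assumes "bounded_domain D" and "B_regular D"
    and "\<phi> \<in> PSH_neg D"
    and "(\<exists>w\<in>PSH_neg D. (\<forall>z\<in>D. green_poisson D \<phi> z + w z \<le> \<phi> z) \<and>
            (\<forall>z\<in>D. green_poisson D w z = 0))
         \<or> (\<forall>z\<in>D. green_poisson D \<phi> z = 0)
         \<or> approx_model_singularity D \<phi>"
  shows "\<forall>\<psi>\<in>PSH_neg D. \<forall>z\<in>D.
           asymptotic_rooftop D \<phi> \<psi> z = rooftop D \<psi> (green_poisson D \<phi>) z"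
proof (intro ballI antisym)
  fix \<psi> z assume \<psi>: "\<psi> \<in> PSH_neg D" and z: "z \<in> D"
  have D: "open D" using assms(1) by (simp add: bounded_domain_def)
  show "asymptotic_rooftop D \<phi> \<psi> z \<le> rooftop D \<psi> (green_poisson D \<phi>) z"
    by (rule asymptotic_rooftop_le[OF D assms(3) \<psi> z])
  consider (sum) w where "w \<in> PSH_neg D" "\<And>z. z \<in> D \<Longrightarrow> green_poisson D \<phi> z + w z \<le> \<phi> z"
      "\<And>z. z \<in> D \<Longrightarrow> green_poisson D w z = 0"
    | (zero) "\<And>z. z \<in> D \<Longrightarrow> green_poisson D \<phi> z = 0"
    | (model) "approx_model_singularity D \<phi>"
    using assms(4) by blast
  then show "rooftop D \<psi> (green_poisson D \<phi>) z \<le> asymptotic_rooftop D \<phi> \<psi> z"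
  proof cases
    case sum
    then show ?thesis by (rule rooftop_le_of_green_poisson_zero[OF D assms(3) \<psi> _ _ _ z])
  next
    case zero
    \<comment> \<open>With \<open>w = \<phi>\<close> the required inequality reads 0 + \<phi> \<le>
      \<phi>.\<close>
    then show ?thesis
      by (intro rooftop_le_of_green_poisson_zero[OF D assms(3) \<psi> assms(3) _ _ z]) simp_all
  next
    case model
    then show ?thesis by (rule rooftop_le_of_approx_model_singularity[OF D assms(3) \<psi> _ z])
  qed
qed

end
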